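(* Assume that $V^\lambda_h\subseteq V^\varphi_h$. Then $$\sup_{(\mathbf d_h,\mu_h,\varphi_h)\in\mathbf V_h\setminus\{(\mathbf 0,0,0)\}}\frac{|\langle\mathcal B_h(\mathbf d_h,\mu_h,\varphi_h),\lambda_h^*\rangle|}{\|(\mathbf d_h,\mu_h,\varphi_h)\|_{\mathbf V}}\ \ge\ \|\lambda_h^*\|_{0,\Omega}\qquad\text{for all }\lambda_h^*\in Q_h.$$
   Context: $\Omega\subset\mathbb R^d$, $d\in\{2,3\}$, is a bounded domain with Lipschitz boundary; $(\cdot,\cdot)$ is the $L^2(\Omega)$ inner product, $\|\cdot\|_{0,\Omega}$, $\|\cdot\|_{1,\Omega}$ are the $L^2(\Omega)$ and $H^1(\Omega)$ norms. $\mathbf V:=H^1_0(\Omega)^d\times H^1_0(\Omega)\times L^2(\Omega)$ with $\|(\mathbf d,\mu,\varphi)\|_{\mathbf V}^2:=\|\mathbf d\|_{1,\Omega}^2+\|\mu\|_{1,\Omega}^2+\|\varphi\|_{0,\Omega}^2$. The conforming discrete spaces are (finite-dimensional) subspaces $\mathbf V^{\mathbf d}_h\subset H^1_0(\Omega)^d$, $V^\mu_h\subset H^1_0(\Omega)$, $V^\varphi_h\subset L^2(\Omega)$, $V^\lambda_h\subset L^2(\Omega)$; $\mathbf V_h:=\mathbf V^{\mathbf d}_h\times V^\mu_h\times V^\varphi_h$ and $Q_h:=V^\lambda_h$ (with the $L^2(\Omega)$ norm). $\mathcal B_h:\mathbf V_h\to Q_h'$ is given by $\langle\mathcal B_h(\mathbf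 d_h,\mu_h,\varphi_h),\lambda_h^*\rangle:=(\lambda_h^*,\operatorname{div}\mathbf d_h)-(\varphi_h,\lambda_h^* )$. *)

theory Defs
  imports "HOL-Analysis.Analysis" "HOL-Library.Function_Algebras"
begin

text \<open>Functions form a real vector space pointwise, so that the library's notions
  \<open>subspace\<close> and \<open>span\<close> apply to function spaces and to their products.\<close>

instantiation "fun" :: (type, real_vector) real_vector
begin

definition scaleR_fun :: "real \<Rightarrow> ('a \<Rightarrow> 'b) \<Rightarrow> 'a \<Rightarrow> 'b"
  where "scaleR_fun c f = (\<lambda>x. c *\<^sub>R f x)"

instance
  by standard (auto simp: scaleR_fun_def fun_eq_iff algebra_simps)

end

text \<open>Near every boundary point, \<open>\<Omega>\<close> is the strict epigraph, in some direction \<open>e\<close>, of a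
  Lipschitz function on the hyperplane orthogonal to \<open>e\<close>.\<close>

definition lipschitz_boundary :: "(real ^ 'n) set \<Rightarrow> bool" where
  "lipschitz_boundary \<Omega> \<longleftrightarrow>
     (\<forall>x\<in>frontier \<Omega>. \<exists>U e L \<gamma>. open U \<and> x \<in> U \<and> norm e = 1 \<and>
        lipschitz_on L {z. e \<bullet> z = 0} (\<gamma> :: real ^ 'n \<Rightarrow> real) \<and>
        \<Omega> \<inter> U = {y\<in>U. \<gamma> (y - (e \<bullet> y) *\<^sub>R e) < e \<bullet> y})"

definition bounded_lipschitz_domain :: "(real ^ 'n) set \<Rightarrow> bool" where
  "bounded_lipschitz_domain \<Omega> \<longleftrightarrow>
     open \<Omega> \<and> connected \<Omega> \<and> \<Omega> \<noteq> {} \<and> bounded \<Omega> \<and> lipschitz_boundary \<Omega>"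

text \<open>Elements of \<open>L\<^sup>2(\<Omega>)\<close> are given by representatives defined on the whole space, of which only
  the values on \<open>\<Omega>\<close> matter and which are identified if they agree almost everywhere on \<open>\<Omega>\<close>.\<close>

definition ae_eq :: "(real ^ 'n) set \<Rightarrow> (real ^ 'n \<Rightarrow> 'b) \<Rightarrow> (real ^ 'n \<Rightarrow> 'b) \<Rightarrow> bool" where
  "ae_eq \<Omega> f g \<longleftrightarrow> (AE x in lebesgue_on \<Omega>. f x = g x)"

definition L2 :: "(real ^ 'n) set \<Rightarrow> (real ^ 'n \<Rightarrow> real) set" where
  "L2 \<Omega> = {f \<in> borel_measurable (lebesgue_on \<Omega>). integrable (lebesgue_on \<Omega>) (\<lambda>x. (f x)\<^sup>2)}"

definition L2_inner :: "(real ^ 'n) set \<Rightarrow> (real ^ 'n \<Rightarrow> real) \<Rightarrow> (real ^ 'n \<Rightarrow> real) \<Rightarrow> real" where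
  "L2_inner \<Omega> f g = (LINT x|lebesgue_on \<Omega>. f x * g x)"

definition L2_norm :: "(real ^ 'n) set \<Rightarrow> (real ^ 'n \<Rightarrow> real) \<Rightarrow> real" where
  "L2_norm \<Omega> f = sqrt (L2_inner \<Omega> f f)"

definition partial :: "'n \<Rightarrow> (real ^ 'n \<Rightarrow> real) \<Rightarrow> real ^ 'n \<Rightarrow> real" where
  "partial i f x = frechet_derivative f (at x) (axis i 1)"

primrec C_k :: "nat \<Rightarrow> (real ^ 'n \<Rightarrow> real) \<Rightarrow> bool" where
  "C_k 0 f \<longleftrightarrow> continuous_on UNIV f"
| "C_k (Suc k) f \<longleftrightarrow> (\<forall>x. f differentiable (at x)) \<and> (\<forall>i. C_k k (partial i f))"

text \<open>\<open>C\<^sub>c\<^sup>\<infinity>(\<Omega>)\<close>, with functions extended by zero to the whole space.\<close>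

definition test_functions :: "(real ^ 'n) set \<Rightarrow> (real ^ 'n \<Rightarrow> real) set" where
  "test_functions \<Omega> =
     {\<psi>. (\<forall>k. C_k k \<psi>) \<and> compact (closure {x. \<psi> x \<noteq> 0}) \<and> closure {x. \<psi> x \<noteq> 0} \<subseteq> \<Omega>}"

definition is_weak_partial ::
    "(real ^ 'n) set \<Rightarrow> 'n \<Rightarrow> (real ^ 'n \<Rightarrow> real) \<Rightarrow> (real ^ 'n \<Rightarrow> real) \<Rightarrow> bool" where
  "is_weak_partial \<Omega> i f g \<longleftrightarrow>
     (\<forall>\<psi>\<in>test_functions \<Omega>. L2_inner \<Omega> f (partial i \<psi>) = - L2_inner \<Omega> g \<psi>)"

definition H1 :: "(real ^ 'n) set \<Rightarrow> (real ^ 'n \<Rightarrow> real) set" where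
  "H1 \<Omega> = {f \<in> L2 \<Omega>. \<forall>i. \<exists>g\<in>L2 \<Omega>. is_weak_partial \<Omega> i f g}"

text \<open>A representative of the weak derivative, which is unique up to \<^const>\<open>ae_eq\<close>.\<close>

definition weak_partial ::
    "(real ^ 'n) set \<Rightarrow> 'n \<Rightarrow> (real ^ 'n \<Rightarrow> real) \<Rightarrow> real ^ 'n \<Rightarrow> real" where
  "weak_partial \<Omega> i f = (SOME g. g \<in> L2 \<Omega> \<and> is_weak_partial \<Omega> i f g)"

definition H1_norm :: "(real ^ 'n) set \<Rightarrow> (real ^ 'n \<Rightarrow> real) \<Rightarrow> real" where
  "H1_norm \<Omega> f = sqrt ((L2_norm \<Omega> f)\<^sup>2 + (\<Sum>i\<in>UNIV. (L2_norm \<Omega> (weak_partial \<Omega> i f))\<^sup>2))"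

definition H10 :: "(real ^ 'n) set \<Rightarrow> (real ^ 'n \<Rightarrow> real) set" where
  "H10 \<Omega> = {f \<in> H1 \<Omega>. \<exists>\<psi>. (\<forall>m. \<psi> m \<in> test_functions \<Omega>) \<and>
              (\<lambda>m::nat. H1_norm \<Omega> (f - \<psi> m)) \<longlonglongrightarrow> 0}"

definition component :: "'n \<Rightarrow> (real ^ 'n \<Rightarrow> real ^ 'n) \<Rightarrow> real ^ 'n \<Rightarrow> real" where
  "component i d x = d x $ i"

definition H10_vec :: "(real ^ 'n) set \<Rightarrow> (real ^ 'n \<Rightarrow> real ^ 'n) set" where
  "H10_vec \<Omega> = {d. \<forall>i. component i d \<in> H10 \<Omega>}"

definition H1_norm_vec :: "(real ^ 'n) set \<Rightarrow> (real ^ 'n \<Rightarrow> real ^ 'n) \<Rightarrow> real" where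
  "H1_norm_vec \<Omega> d = sqrt (\<Sum>i\<in>UNIV. (H1_norm \<Omega> (component i d))\<^sup>2)"

definition weak_div :: "(real ^ 'n) set \<Rightarrow> (real ^ 'n \<Rightarrow> real ^ 'n) \<Rightarrow> real ^ 'n \<Rightarrow> real" where
  "weak_div \<Omega> d = (\<Sum>i\<in>UNIV. weak_partial \<Omega> i (component i d))"

text \<open>A set of representatives stands for a set of almost-everywhere classes when it is closed under
  \<^const>\<open>ae_eq\<close>; inclusions of such sets are then exactly inclusions of sets of classes.
  Finite dimension refers to the classes, hence spanning only up to \<^const>\<open>ae_eq\<close>.\<close>

definition findim_subspace :: "(real ^ 'n) set \<Rightarrow> (real ^ 'n \<Rightarrow> 'b::real_vector) set \<Rightarrow> bool" where
  "findim_subspace \<Omega> V \<longleftrightarrow>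
     subspace V \<and> (\<forall>f\<in>V. \<forall>g. ae_eq \<Omega> f g \<longrightarrow> g \<in> V) \<and>
     (\<exists>B. finite B \<and> B \<subseteq> V \<and> (\<forall>f\<in>V. \<exists>g\<in>span B. ae_eq \<Omega> f g))"

type_synonym 'n triple_field =
  "(real ^ 'n \<Rightarrow> real ^ 'n) \<times> (real ^ 'n \<Rightarrow> real) \<times> (real ^ 'n \<Rightarrow> real)"

definition V_norm :: "(real ^ 'n) set \<Rightarrow> 'n triple_field \<Rightarrow> real" where
  "V_norm \<Omega> = (\<lambda>(d, \<mu>, \<phi>).
     sqrt ((H1_norm_vec \<Omega> d)\<^sup>2 + (H1_norm \<Omega> \<mu>)\<^sup>2 + (L2_norm \<Omega> \<phi>)\<^sup>2))"

text \<open>The representatives of \<open>(0, 0, 0)\<close>.\<close>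

definition V_zero :: "(real ^ 'n) set \<Rightarrow> 'n triple_field set" where
  "V_zero \<Omega> = {(d, \<mu>, \<phi>). ae_eq \<Omega> d 0 \<and> ae_eq \<Omega> \<mu> 0 \<and> ae_eq \<Omega> \<phi> 0}"

definition B_h :: "(real ^ 'n) set \<Rightarrow> 'n triple_field \<Rightarrow> (real ^ 'n \<Rightarrow> real) \<Rightarrow> real" where
  "B_h \<Omega> = (\<lambda>(d, \<mu>, \<phi>) l. L2_inner \<Omega> l (weak_div \<Omega> d) - L2_inner \<Omega> \<phi> l)"

end

theory Submission
  imports Defs "HOL-Real_Asymp.Real_Asymp"
begin

text \<open>Since \<open>Vlam \<subseteq> Vphi\<close>, the triples \<open>(0, 0, t l)\<close> with \<open>t > 0\<close> compete in the supremum.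
  If the chosen weak derivatives of \<open>0\<close> are zero, \<open>t = 1\<close> already gives the quotient
  \<open>\<parallel>l\<parallel>\<^sup>2 / \<parallel>l\<parallel> = \<parallel>l\<parallel>\<close>. But \<^const>\<open>weak_partial\<close> selects an arbitrary \<open>L\<^sup>2\<close> function orthogonal
  to all test functions, and identifying it with zero would take the fundamental lemma of the
  calculus of variations. Letting \<open>t\<close> grow treats every selection alike: the \<open>0\<close> components
  contribute a number \<open>a\<close> to the numerator and a number \<open>c \<ge> 0\<close> to the square of the
  denominator, neither depending on \<open>t\<close>. With \<open>r = \<parallel>l\<parallel>\<close> the quotient is
  \<open>\<bar>a - t r\<^sup>2\<bar> / sqrt (c + (t r)\<^sup>2)\<close>, in which the terms with \<open>t\<close> dominate, so that it tends to
  \<open>r\<close> (\<open>quotient_tendsto\<close>); a supremum is at least every limit of its members. If \<open>r = 0\<close>,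
  the bound is trivial.\<close>

lemma L2_inner_self_nonneg: "0 \<le> L2_inner \<Omega> f f"
  unfolding L2_inner_def by (rule integral_nonneg_AE) simp

lemma L2_norm_power2: "(L2_norm \<Omega> f)\<^sup>2 = L2_inner \<Omega> f f"
  by (simp add: L2_norm_def L2_inner_self_nonneg)

lemma L2_norm_nonneg: "0 \<le> L2_norm \<Omega> f"
  by (simp add: L2_norm_def L2_inner_self_nonneg)

lemma L2_inner_scaleR_left: "L2_inner \<Omega> (t *\<^sub>R f) g = t * L2_inner \<Omega> f g"
  by (simp add: L2_inner_def scaleR_fun_def mult.assoc)

lemma L2_norm_scaleR: "L2_norm \<Omega> (t *\<^sub>R f) = \<bar>t\<bar> * L2_norm \<Omega> f"
proof -
  have "L2_inner \<Omega> (t *\<^sub>R f) (t *\<^sub>R f) = t\<^sup>2 * L2_inner \<Omega> f f"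
    by (simp add: L2_inner_def scaleR_fun_def power2_eq_square mult_ac)
  then show ?thesis
    by (simp add: L2_norm_def real_sqrt_mult)
qed

lemma L2_norm_ae_zero:
  assumes "ae_eq \<Omega> f 0"
  shows "L2_norm \<Omega> f = 0"
proof -
  have "AE x in lebesgue_on \<Omega>. f x * f x = 0"
    using assms unfolding ae_eq_def by eventually_elim simp
  then show ?thesis
    by (simp add: L2_norm_def L2_inner_def integral_eq_zero_AE)
qed

lemma quotient_tendsto:
  fixes a c r :: real
  assumes "r > 0"
  shows "((\<lambda>t. \<bar>a - t * r\<^sup>2\<bar> / sqrt (c + (t * r)\<^sup>2)) \<longlongrightarrow> r) at_top"
proof -
  have "((\<lambda>t. \<bar>a - t * r\<^sup>2\<bar> / sqrt (c + (t * r)\<^sup>2)) \<longlongrightarrow> r\<^sup>2 * inverse \<bar>r\<bar>) at_top"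
    using assms by real_asymp
  also have "r\<^sup>2 * inverse \<bar>r\<bar> = r"
    using assms by (simp add: power2_eq_square)
  finally show ?thesis .
qed

theorem lemma3p1:
  fixes \<Omega> :: "(real ^ 'n) set"
    and Vd :: "(real ^ 'n \<Rightarrow> real ^ 'n) set"
    and Vmu Vphi Vlam :: "(real ^ 'n \<Rightarrow> real) set"
  assumes "CARD('n) \<in> {2, 3}"
    and "bounded_lipschitz_domain \<Omega>"
    and "findim_subspace \<Omega> Vd" and "Vd \<subseteq> H10_vec \<Omega>"
    and "findim_subspace \<Omega> Vmu" and "Vmu \<subseteq> H10 \<Omega>"
    and "findim_subspace \<Omega> Vphi" and "Vphi \<subseteq> L2 \<Omega>"
    and "findim_subspace \<Omega> Vlam" and "Vlam \<subseteq> L2 \<Omega>"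
    and "Vlam \<subseteq> Vphi"
  shows "\<forall>l\<in>Vlam.
    (SUP v \<in> (Vd \<times> Vmu \<times> Vphi) - V_zero \<Omega>. ennreal (\<bar>B_h \<Omega> v l\<bar> / V_norm \<Omega> v))
      \<ge> ennreal (L2_norm \<Omega> l)"
proof
  fix l assume l: "l \<in> Vlam"
  let ?S = "(Vd \<times> Vmu \<times> Vphi) - V_zero \<Omega>"
  let ?q = "\<lambda>v. \<bar>B_h \<Omega> v l\<bar> / V_norm \<Omega> v"
  define r where "r = L2_norm \<Omega> l"
  show "ennreal (L2_norm \<Omega> l) \<le> (SUP v \<in> ?S. ennreal (?q v))"
  proof (cases "r = 0")
    case True
    then show ?thesis by (simp add: r_def)
  next
    case False
    then have r: "r > 0"
      using L2_norm_nonneg[of \<Omega> l] by (simp add: r_def)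
    define a where "a = L2_inner \<Omega> l (weak_div \<Omega> 0)"
    define c where "c = (H1_norm_vec \<Omega> 0)\<^sup>2 + (H1_norm \<Omega> 0)\<^sup>2"
    define v :: "real \<Rightarrow> 'n triple_field" where "v t = (0, 0, t *\<^sub>R l)" for t
    have q_v: "?q (v t) = \<bar>a - t * r\<^sup>2\<bar> / sqrt (c + (t * r)\<^sup>2)" for t
    proof -
      have "B_h \<Omega> (v t) l = a - t * r\<^sup>2"
        by (simp add: v_def B_h_def a_def r_def L2_inner_scaleR_left L2_norm_power2)
      moreover have "V_norm \<Omega> (v t) = sqrt (c + (t * r)\<^sup>2)"
        by (simp add: v_def V_norm_def c_def r_def L2_norm_scaleR power_mult_distrib)
      ultimately show ?thesis by simp
    qed
    have v_in: "v t \<in> ?S" if "t > 0" for t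
    proof -
      have "0 \<in> Vd" "0 \<in> Vmu" "t *\<^sub>R l \<in> Vphi"
        using assms l by (auto simp: findim_subspace_def subspace_0 subspace_scale)
      moreover have "\<not> ae_eq \<Omega> (t *\<^sub>R l) 0"
        using L2_norm_ae_zero[of \<Omega> "t *\<^sub>R l"] that r by (auto simp: L2_norm_scaleR r_def)
      ultimately show ?thesis by (simp add: v_def V_zero_def)
    qed
    have "((\<lambda>t. ennreal (?q (v t))) \<longlongrightarrow> ennreal r) at_top"
      unfolding q_v by (intro tendsto_ennrealI quotient_tendsto r)
    moreover have "\<forall>\<^sub>F t in at_top. ennreal (?q (v t)) \<le> (SUP v \<in> ?S. ennreal (?q v))"
      using eventually_gt_at_top[of 0] by eventually_elim (rule SUP_upper[OF v_in])
    ultimately show ?thesis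
      unfolding r_def by (rule tendsto_upperbound) simp
  qed
qed

end
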